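(* Let $\{Q_p(x)\}_{p\ge0}$ be a sequence of orthogonal polynomials given by a Favard recurrence with coefficients $A_p,B_p,C_p$ as in the context, so that $Q_{p-t}(x)=\psi_{p-t}^{(p)}(x)Q_p(x)+\psi_{p-t}^{(p-1)}(x)Q_{p-1}(x)$ for $1\le t\le p$, with the coefficient functions $\psi$ defined in the context. Let $p\ge 1$ be an integer. Then: (a) for every $t$ with $1\le t\le p$, no real $x$ satisfies both $\psi_{p-t}^{(p)}(x)=0$ and $\psi_{p-t}^{(p-1)}(x)=0$; (b) for every $t$ with $2\le t\le p$, no real $x$ satisfies both $\psi_{p-t+1}^{(p)}(x)=0$ and $\psi_{p-t}^{(p)}(x)=0$; (c) for every $t$ with $2\le t\le p$, no real $x$ satisfies both $\psi_{p-t+1}^{(p-1)}(x)=0$ and $\psi_{p-t}^{(p-1)}(x)=0$.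
   Context: The sequence satisfies $Q_{p+1}(x)=(A_px+B_p)Q_p(x)-C_pQ_{p-1}(x)$ for $p\ge0$, with $Q_0(x)=1$, $Q_{-1}(x)=0$, where $(A_p),(B_p),(C_p)$ are real sequences with $A_p\ne0$ for all $p\ge 0$, and $C_p\neq 0$ and $C_pA_pA_{p-1}>0$ for all $p\ge 1$ ($C_0$ is irrelevant since $Q_{-1}=0$). For $i\ge1$ put $T_i(x)=(A_ix+B_i)/C_i$ and $D_i=1/C_i$. For fixed $p\ge1$, the functions $\psi_{p-t}^{(p)},\psi_{p-t}^{(p-1)}$ ($1\le t\le p$) are defined by $\psi_{p-1}^{(p)}(x)=0$, $\psi_{p-1}^{(p-1)}(x)=1$; $\psi_{p-2}^{(p)}(x)=-D_{p-1}$, $\psi_{p-2}^{(p-1)}(x)=T_{p-1}(x)$; and for $t\ge3$ and each $j\in\{p,p-1\}$, $\psi_{p-t}^{(j)}(x)=T_{p-t+1}(x)\psi_{p-t+1}^{(j)}(x)-D_{p-t+1}\psi_{p-t+2}^{(j)}(x)$. *)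

theory Defs
  imports Complex_Main "HOL-Computational_Algebra.Polynomial"
begin

definition favard_coeffs :: "(nat \<Rightarrow> real) \<Rightarrow> (nat \<Rightarrow> real) \<Rightarrow> bool" where
  "favard_coeffs A C \<longleftrightarrow>
     (\<forall>p. A p \<noteq> 0) \<and> (\<forall>p\<ge>1. C p \<noteq> 0 \<and> C p * A p * A (p - 1) > 0)"

text \<open>The conditional encodes the convention that the polynomial with index \<open>-1\<close> is zero.\<close>

definition favard_recurrence ::
  "(nat \<Rightarrow> real) \<Rightarrow> (nat \<Rightarrow> real) \<Rightarrow> (nat \<Rightarrow> real) \<Rightarrow> (nat \<Rightarrow> real poly) \<Rightarrow> bool" where
  "favard_recurrence A B C Q \<longleftrightarrow>
     Q 0 = 1 \<and>
     (\<forall>p. Q (p + 1) = [:B p, A p:] * Q p - smult (C p) (if p = 0 then 0 else Q (p - 1)))"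

definition T :: "(nat \<Rightarrow> real) \<Rightarrow> (nat \<Rightarrow> real) \<Rightarrow> (nat \<Rightarrow> real) \<Rightarrow> nat \<Rightarrow> real \<Rightarrow> real" where
  "T A B C i x = (A i * x + B i) / C i"

definition D :: "(nat \<Rightarrow> real) \<Rightarrow> nat \<Rightarrow> real" where
  "D C i = 1 / C i"

text \<open>\<open>psi A B C p j n\<close> is the function with subscript \<open>n\<close> and superscript \<open>(j)\<close> belonging to
  the fixed index \<open>p\<close>. It is meant for \<open>n < p\<close> and \<open>j \<in> {p, p - 1}\<close> only; other values are
  arbitrary. The recursion descends from \<open>n = p - 1\<close>; \<open>psi_first\<close>, \<open>psi_second\<close> and \<open>psi_step\<close>
  below restate it in terms of \<open>t = p - n\<close>.\<close>

function psi ::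
  "(nat \<Rightarrow> real) \<Rightarrow> (nat \<Rightarrow> real) \<Rightarrow> (nat \<Rightarrow> real) \<Rightarrow> nat \<Rightarrow> nat \<Rightarrow> nat \<Rightarrow> real \<Rightarrow> real" where
  "psi A B C p j n x =
     (if p \<le> n + 1 then (if j = p then 0 else 1)
      else if p = n + 2 then (if j = p then - D C (p - 1) else T A B C (p - 1) x)
      else T A B C (n + 1) x * psi A B C p j (n + 1) x - D C (n + 1) * psi A B C p j (n + 2) x)"
  by pat_completeness auto
termination by (relation "measure (\<lambda>(A, B, C, p, j, n, x). p - n)") auto

declare psi.simps [simp del]

lemma psi_first:
  assumes "p \<ge> 1"
  shows "psi A B C p p (p - 1) x = 0" and "psi A B C p (p - 1) (p - 1) x = 1"
  using assms by (subst psi.simps; auto)+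

lemma psi_second:
  assumes "p \<ge> 2"
  shows "psi A B C p p (p - 2) x = - D C (p - 1)"
    and "psi A B C p (p - 1) (p - 2) x = T A B C (p - 1) x"
  using assms by (subst psi.simps; auto)+

lemma psi_step:
  assumes "3 \<le> t" "t \<le> p"
  shows "psi A B C p j (p - t) x =
    T A B C (p - t + 1) x * psi A B C p j (p - t + 1) x
      - D C (p - t + 1) * psi A B C p j (p - t + 2) x"
  using assms by (subst psi.simps) auto

lemma favard_backward:
  assumes "favard_coeffs A C" "favard_recurrence A B C Q"
  shows "poly (Q n) x = T A B C (n + 1) x * poly (Q (n + 1)) x - D C (n + 1) * poly (Q (n + 2)) x"
proof -
  have c: "C (n + 1) \<noteq> 0"
    using assms(1) by (simp add: favard_coeffs_def)
  have "Q (n + 1 + 1) = [:B (n + 1), A (n + 1):] * Q (n + 1) - smult (C (n + 1)) (Q n)"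
    using assms(2) unfolding favard_recurrence_def 
    by (auto dest!: spec[of _ "n + 1"])
  then have "poly (Q (n + 2)) x =
      (A (n + 1) * x + B (n + 1)) * poly (Q (n + 1)) x - C (n + 1) * poly (Q n) x"
    by (simp add: ring_distribs mult.commute mult.left_commute del: mult_pCons_left)
  then have "poly (Q n) x =
      ((A (n + 1) * x + B (n + 1)) * poly (Q (n + 1)) x - poly (Q (n + 2)) x) / C (n + 1)"
    using c by (simp add: eq_divide_eq mult.commute)
  then show ?thesis
    by (simp add: T_def D_def diff_divide_distrib)
qed

lemma psi_representation:
  assumes "favard_coeffs A C" "favard_recurrence A B C Q" "1 \<le> t" "t \<le> p"
  shows "poly (Q (p - t)) x =
    psi A B C p p (p - t) x * poly (Q p) x + psi A B C p (p - 1) (p - t) x * poly (Q (p - 1)) x"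
  using assms(3,4)
proof (induction t rule: less_induct)
  case (less t)
  consider "t = 1" | "t = 2" | "t \<ge> 3" using less.prems by linarith
  then show ?case
  proof cases
    case 1
    then show ?thesis using less.prems psi_first[of p] by simp
  next
    case 2
    then have "p - 2 + 1 = p - 1" "p - 2 + 2 = p" using less.prems by auto
    then show ?thesis
      using 2 less.prems psi_second[of p] favard_backward[OF assms(1,2), of "p - 2" x] by simp
  next
    case 3
    have e: "p - (t - 1) = p - t + 1" "p - (t - 2) = p - t + 2" using 3 less.prems by auto
    have "poly (Q (p - t + 1)) x = psi A B C p p (p - t + 1) x * poly (Q p) x
        + psi A B C p (p - 1) (p - t + 1) x * poly (Q (p - 1)) x"
      using less.IH[of "t - 1"] 3 less.prems unfolding e by simp
    moreover have "poly (Q (p - t + 2)) x = psi A B C p p (p - t + 2) x * poly (Q p) x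
        + psi A B C p (p - 1) (p - t + 2) x * poly (Q (p - 1)) x"
      using less.IH[of "t - 2"] 3 less.prems unfolding e by simp
    ultimately show ?thesis
      unfolding favard_backward[OF assms(1,2), of "p - t" x] psi_step[OF 3 less.prems(2)]
      by (simp add: algebra_simps)
  qed
qed

end

theory Submission
  imports Defs
begin

text \<open>For fixed \<open>p\<close> and \<open>x\<close>, the two families of coefficients with superscripts \<open>(p)\<close> and
  \<open>(p - 1)\<close> solve the same linear second-order recurrence in the subscript. Their Casoratian
  (the discrete Wronskian) is therefore multiplied by a factor \<open>D\<^sub>n\<^sub>+\<^sub>1\<close> when the subscript
  descends from \<open>n + 1\<close> to \<open>n\<close>, so it is a product of the numbers \<open>D\<^sub>i = 1 / C\<^sub>i\<close> and does not
  vanish, whatever \<open>x\<close> is (\<open>psi_casoratian\<close>, \<open>psi_casoratian_nonzero\<close>). Viewing it as the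
  determinant of the \<open>2 \<times> 2\<close> matrix of coefficients with two consecutive subscripts and the two
  superscripts, a common zero as in (a) would annihilate one row, and a common zero as in (b) or
  (c) would annihilate one column. Only \<open>t = 1\<close> in (a) has no such matrix; there one of the two
  functions is constantly \<open>1\<close>.\<close>

text \<open>The term with factor \<open>T\<^sub>n\<^sub>+\<^sub>1\<close> contributes equally to both products and cancels; what
  remains is \<open>D\<^sub>n\<^sub>+\<^sub>1\<close> times the Casoratian one subscript higher. The two initial values give
  \<open>D\<^sub>p\<^sub>-\<^sub>1\<close> at \<open>n = p - 2\<close>.\<close>

lemma psi_casoratian:
  assumes "n + 2 \<le> p"
  shows "psi A B C p p (n + 1) x * psi A B C p (p - 1) n x
       - psi A B C p p n x * psi A B C p (p - 1) (n + 1) x = (\<Prod>i = n + 1..p - 1. D C i)"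
proof -
  define m where "m = p - 2"
  have p: "p = m + 2" and "n \<le> m"
    using assms by (auto simp: m_def)
  from \<open>n \<le> m\<close> show ?thesis
  proof (induction n rule: inc_induct)
    case base
    show ?case
      using psi_first[of p A B C x] psi_second[of p A B C x] by (simp add: p)
  next
    case (step n)
    have rec: "psi A B C p j n x = T A B C (n + 1) x * psi A B C p j (n + 1) x
                 - D C (n + 1) * psi A B C p j (n + 2) x" for j
      using psi_step[of "p - n" p A B C j x] step.hyps by (simp add: p)
    have "psi A B C p p (n + 1) x * psi A B C p (p - 1) n x
            - psi A B C p p n x * psi A B C p (p - 1) (n + 1) x
        = D C (n + 1) * (psi A B C p p (n + 2) x * psi A B C p (p - 1) (n + 1) x
            - psi A B C p p (n + 1) x * psi A B C p (p - 1) (n + 2) x)"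
      unfolding rec[of p] rec[of "p - 1"] by (simp add: algebra_simps)
    also have "\<dots> = D C (n + 1) * (\<Prod>i = n + 2..p - 1. D C i)"
      using step.IH by simp
    also have "\<dots> = (\<Prod>i = n + 1..p - 1. D C i)"
      using step.hyps by (simp add: p prod.atLeast_Suc_atMost)
    finally show ?case .
  qed
qed

lemma psi_casoratian_nonzero:
  assumes "favard_coeffs A C" "2 \<le> t" "t \<le> p"
  shows "psi A B C p p (p - t + 1) x * psi A B C p (p - 1) (p - t) x
       - psi A B C p p (p - t) x * psi A B C p (p - 1) (p - t + 1) x \<noteq> 0"
proof -
  have "(\<Prod>i = p - t + 1..p - 1. D C i) \<noteq> 0"
    using assms(1) by (auto simp: D_def favard_coeffs_def)
  then show ?thesis
    using psi_casoratian[of "p - t" p A B C x] assms(2,3) by simp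
qed

theorem lemma2:
  fixes A B C :: "nat \<Rightarrow> real" and Q :: "nat \<Rightarrow> real poly" and p :: nat
  assumes "favard_coeffs A C"
    and "favard_recurrence A B C Q"
    and "p \<ge> 1"
  shows "(\<forall>t. 1 \<le> t \<and> t \<le> p \<longrightarrow>
            \<not> (\<exists>x::real. psi A B C p p (p - t) x = 0 \<and> psi A B C p (p - 1) (p - t) x = 0))
       \<and> (\<forall>t. 2 \<le> t \<and> t \<le> p \<longrightarrow>
            \<not> (\<exists>x::real. psi A B C p p (p - t + 1) x = 0 \<and> psi A B C p p (p - t) x = 0))
       \<and> (\<forall>t. 2 \<le> t \<and> t \<le> p \<longrightarrow>
            \<not> (\<exists>x::real. psi A B C p (p - 1) (p - t + 1) x = 0 \<and> psi A B C p (p - 1) (p - t) x = 0))"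
proof (intro conjI allI impI notI; elim exE conjE)
  fix t and x :: real
  assume t: "1 \<le> t" "t \<le> p"
    and zero: "psi A B C p p (p - t) x = 0" "psi A B C p (p - 1) (p - t) x = 0"
  show False
  proof (cases "t = 1")
    case True
    then show False
      using zero(2) psi_first(2)[OF assms(3), of A B C x] by simp
  next
    case False
    then show False
      using psi_casoratian_nonzero[OF assms(1), of t p B x] t zero by simp
  qed
next
  fix t and x :: real
  assume "2 \<le> t" "t \<le> p" "psi A B C p p (p - t + 1) x = 0" "psi A B C p p (p - t) x = 0"
  then show False
    using psi_casoratian_nonzero[OF assms(1), of t p B x] by simp
next
  fix t and x :: real
  assume "2 \<le> t" "t \<le> p"
    "psi A B C p (p - 1) (p - t + 1) x = 0" "psi A B C p (p - 1) (p - t) x = 0"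
  then show False
    using psi_casoratian_nonzero[OF assms(1), of t p B x] by simp
qed

end
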